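(* Let $G\in\{\mathrm{A}_n,\mathrm{S}_n\}$, and let $\rho_G$ be the proportion of permutations $g\in G$ for which some power of $g$ is a cycle of prime length $p$, where $p$ lies in the open interval $(\log n,\ (\log n)^{\log\log n})$. Then, for $n$ sufficiently large, $$\rho_G\ \ge\ 1-\frac{c}{\log\log n},$$ where $c=5$ when $G=\mathrm{S}_n$, and $c=7$ when $G=\mathrm{A}_n$.
   Context: $\mathrm{S}_n$ and $\mathrm{A}_n$ denote the symmetric and alternating groups of degree $n$. All logarithms are natural and $\log\log n=\log(\log n)$. A cycle of length $p$ (a $p$-cycle) is a permutation having exactly one cycle of length greater than $1$ in its disjoint cycle decomposition, that cycle having length $p$. The proportion of elements of $G$ with a property is the number of such elements divided by $|G|$. The prime $p$ is allowed to depend on $g$. *)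

theory Defs
  imports
    Complex_Main
    "HOL-Computational_Algebra.Primes"
    "HOL-Combinatorics.Orbits"
    "HOL-Algebra.Sym_Groups"
begin

text \<open>The cycles of a permutation of finite support are its orbits; fixed points are
  the orbits of size one.\<close>

definition is_cycle_perm :: "nat \<Rightarrow> ('a \<Rightarrow> 'a) \<Rightarrow> bool"
  where "is_cycle_perm k h \<longleftrightarrow> permutation h \<and>
    (\<exists>C. {A \<in> range (Orbits.orbit h). 1 < card A} = {C} \<and> card C = k)"

definition prime_cycle_power :: "nat \<Rightarrow> (nat \<Rightarrow> nat) \<Rightarrow> bool"
  where "prime_cycle_power n g \<longleftrightarrow>
    (\<exists>p m :: nat. prime p \<and>
       ln (real n) < real p \<and> real p < ln (real n) powr ln (ln (real n)) \<and>
       is_cycle_perm p (g ^^ m))"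

definition proportion :: "('a, 'b) monoid_scheme \<Rightarrow> ('a \<Rightarrow> bool) \<Rightarrow> real"
  where "proportion G P = real (card {g \<in> carrier G. P g}) / real (order G)"

end

theory Submission
  imports
    Defs
    "HOL-Number_Theory.Cong"
    "HOL-Real_Asymp.Real_Asymp"
begin

text \<open>
  Put \<open>L = ln (ln n)\<close>. If \<open>g\<close> has a cycle of prime length \<open>p\<close> and the length of no other cycle is
  divisible by \<open>p\<close>, then raising \<open>g\<close> to the product of the other cycle lengths kills those cycles
  and leaves a \<open>p\<close>-cycle (\<open>power_is_prime_cycle\<close>). So \<open>g\<close> can fail in two ways only: no cycle
  length lies in the set \<open>T\<close> of admissible primes, or for some \<open>p\<close> in \<open>T\<close> there are two cycles, of
  lengths \<open>p\<close> and \<open>p * k\<close>. Both probabilities are computed for the symmetric group. The alternating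
  group has index two, which at most doubles the proportion of failures; a bound of \<open>7/2 / L\<close> for
  the symmetric group therefore settles both cases.

  Both computations rest on one identity (\<open>perm_mean_remove_cycle\<close>): summing over the points that
  lie on cycles of length \<open>j\<close> a quantity that depends only on \<open>g\<close> off that cycle gives, on average
  over the symmetric group of degree \<open>n\<close>, exactly the average of the quantity in degree \<open>n - j\<close>.

  \<^item> Iterating it shows that the number of cycles with length in \<open>T\<close> has the same low factorial
    moments as a Poisson variable with mean \<open>H\<close>, the sum of the reciprocals of the elements of \<open>T\<close>
    (\<open>perm_mean_choose_cycles\<close>). By Bonferroni's inequalities the first kind of failure has
    probability at most \<open>exp (-H)\<close> plus a negligible term, since the elements of \<open>T\<close> are tiny
    compared with \<open>n\<close>.
  \<^item> Using it twice shows that cycles of lengths \<open>i\<close> and \<open>j\<close> coexist with probability at most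
    \<open>1 / (i * j)\<close>. Summing over \<open>i = p\<close> and \<open>j = p * k\<close> bounds the second kind of failure by
    \<open>(1 + ln n) / a\<close>, where \<open>a\<close> is a lower bound for \<open>T\<close>.

  It remains to choose \<open>T\<close> as the primes in \<open>(a, b]\<close> and to bound \<open>H\<close> from below. Taking \<open>b\<close> just
  below the upper end \<open>exp (L^2)\<close> of the admissible interval, and \<open>a\<close> about \<open>ln n * L^2\<close> rather than
  \<open>ln n\<close>, makes the second kind of failure as rare as \<open>1 / L^2\<close> while \<open>ln a\<close> is still asymptotic to
  \<open>L\<close>. A weak form of Mertens' second theorem (\<open>sum_prime_reciprocals_ge\<close>), obtained from
  Legendre's formula for the factorial by partial summation, gives
  \<open>H \<ge> ln (ln b) - ln (ln a) - 1 - o(1)\<close>, hence \<open>exp (-H) \<le> exp 1 * (1 + o(1)) / L\<close>. As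
  \<open>exp 1 < 7/2\<close>, the loss of the additive constant \<open>1\<close> in Mertens' theorem is harmless.
\<close>

section \<open>Averages over a symmetric group and removal of a cycle\<close>

definition perm_mean :: "'a set \<Rightarrow> (('a \<Rightarrow> 'a) \<Rightarrow> real) \<Rightarrow> real"
  where "perm_mean A F = (\<Sum>g | g permutes A. F g) / fact (card A)"

lemma perm_mean_const: "finite A \<Longrightarrow> perm_mean A (\<lambda>_. c) = c"
  by (simp add: perm_mean_def card_permutations)

lemma perm_mean_mono:
  assumes "\<And>g. g permutes A \<Longrightarrow> F g \<le> G g"
  shows "perm_mean A F \<le> perm_mean A G"
  unfolding perm_mean_def by (intro divide_right_mono sum_mono) (use assms in auto)

lemma perm_mean_cong:
  assumes "\<And>g. g permutes A \<Longrightarrow> F g = G g"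
  shows "perm_mean A F = perm_mean A G"
  unfolding perm_mean_def using assms by (auto intro: sum.cong)

lemma perm_mean_sum:
  "perm_mean A (\<lambda>g. \<Sum>i\<in>I. F i g) = (\<Sum>i\<in>I. perm_mean A (F i))"
  unfolding perm_mean_def by (subst sum.swap) (simp add: sum_divide_distrib)

lemma perm_mean_mult_left: "perm_mean A (\<lambda>g. c * F g) = c * perm_mean A F"
  unfolding perm_mean_def by (simp add: sum_distrib_left)

lemma perm_mean_add: "perm_mean A (\<lambda>g. F g + G g) = perm_mean A F + perm_mean A G"
  unfolding perm_mean_def by (simp add: sum.distrib add_divide_distrib)

lemma sum_permutes_insert:
  fixes F :: "('a \<Rightarrow> 'a) \<Rightarrow> 'b::comm_monoid_add"
  assumes "finite S" "a \<notin> S"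
  shows "(\<Sum>g | g permutes insert a S. F g)
    = (\<Sum>b\<in>insert a S. \<Sum>h | h permutes S. F (transpose a b \<circ> h))"
proof -
  have inj: "inj_on (\<lambda>(b, h). transpose a b \<circ> h) (insert a S \<times> {h. h permutes S})"
  proof (rule inj_onI, clarify)
    fix b h c k
    assume h: "h permutes S" "k permutes S" and eq: "transpose a b \<circ> h = transpose a c \<circ> k"
    have "h a = a" "k a = a"
      using h assms(2) by (auto simp: permutes_not_in)
    with fun_cong[OF eq, of a] have bc: "b = c" by simp
    have "transpose a b \<circ> (transpose a b \<circ> h) = transpose a b \<circ> (transpose a c \<circ> k)"
      by (simp only: eq)
    then have "h = k" by (simp add: bc comp_assoc [symmetric])
    with bc show "b = c \<and> h = k" by simp
  qed
  have "{g. g permutes insert a S}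
      = (\<lambda>(b, h). transpose a b \<circ> h) ` (insert a S \<times> {h. h permutes S})"
    by (subst permutes_insert) (auto simp: image_def)
  then have "(\<Sum>g | g permutes insert a S. F g)
      = (\<Sum>(b, h)\<in>insert a S \<times> {h. h permutes S}. F (transpose a b \<circ> h))"
    by (simp only: sum.reindex[OF inj]) (simp add: case_prod_unfold)
  then show ?thesis by (simp add: sum.cartesian_product)
qed

text \<open>
  Composing with a transposition inserts the fixed point \<open>a\<close> of \<open>h\<close> into the cycle of \<open>b\<close>, just
  before \<open>b\<close>. This makes a cycle one point longer and changes no other cycle, so cycle lengths can be
  treated by induction along \<open>sum_permutes_insert\<close>.
\<close>

lemma orbit_transpose_comp:
  assumes h: "permutation (transpose a b \<circ> h)" and a: "h a = a" and ab: "a \<noteq> b"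
    and hb: "permutation h"
  shows "Orbits.orbit (transpose a b \<circ> h) a = insert a (Orbits.orbit h b)"
proof -
  let ?g = "transpose a b \<circ> h"
  have inj: "h x = h y \<longleftrightarrow> x = y" for x y
    using permutation_bijective[OF hb] by (auto simp: bij_def inj_def)
  have b: "b \<in> Orbits.orbit h b" by (rule permutation_self_in_orbit[OF hb])
  have g: "?g x = (if x = a then b else if h x = b then a else h x)" for x
    using a ab inj[of x a] by (auto simp: transpose_def)
  have "x \<in> insert a (Orbits.orbit h b)" if "x \<in> Orbits.orbit ?g a" for x
    using that
  proof induction
    case base
    show ?case unfolding g using b by simp
  next
    case (step y)
    show ?case unfolding g using b step.IH Orbits.orbit.step[of y h b] by auto
  qed
  moreover have ainO: "a \<in> Orbits.orbit ?g a" by (rule permutation_self_in_orbit[OF h])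
  moreover have binO: "b \<in> Orbits.orbit ?g a" using Orbits.orbit.base[of ?g a] g[of a] by simp
  moreover have "x \<in> Orbits.orbit ?g a" if "x \<in> Orbits.orbit h b" for x
    using that
  proof induction
    case base
    show ?case
    proof (cases "h b = b")
      case False
      then have "h b = ?g b" using g[of b] ab by simp
      then show ?thesis using Orbits.orbit.step[OF binO] by (simp only:)
    qed (use binO in \<open>simp only:\<close>)
  next
    case (step y)
    show ?case
    proof (cases "h y = b \<or> y = a")
      case False
      then have "h y = ?g y" using g[of y] by simp
      then show ?thesis using Orbits.orbit.step[OF step.IH] by (simp only:)
    next
      case True
      then show ?thesis using binO ainO a by (elim disjE) (simp_all only:)
    qed
  qed
  ultimately show ?thesis by blast
qed

text \<open>
  Deleting \<open>a\<close> from its cycle leaves a permutation of the other points with a marked point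
  \<open>b\<close>, the former image of \<open>a\<close>, whose cycle has length \<open>j\<close>; the part off the cycle is
  unchanged. The \<open>card A - 1\<close> choices of \<open>b\<close> produce the factorial. The set passed to \<open>F\<close> records
  on which points the restricted permutation is to be read.
\<close>

lemma sum_perms_rooted_cycle:
  fixes F :: "'a set \<Rightarrow> ('a \<Rightarrow> 'a) \<Rightarrow> real"
  assumes "finite A" "a \<in> A" "Suc j \<le> card A"
    and "\<And>B. B \<subseteq> A \<Longrightarrow> card B = card A - Suc j \<Longrightarrow> perm_mean B (F B) = q"
  shows "(\<Sum>g | g permutes A \<and> card (Orbits.orbit g a) = Suc j.
            F (A - Orbits.orbit g a) (perm_restrict g (A - Orbits.orbit g a)))
       = fact (card A - 1) * q"
  using assms
proof (induction j arbitrary: A a)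
  case 0
  define S where "S = A - {a}"
  have A: "A = insert a S" "a \<notin> S" "finite S" using 0 by (auto simp: S_def)
  have orb: "card (Orbits.orbit g a) = Suc 0 \<longleftrightarrow> Orbits.orbit g a = {a}" if "g permutes A" for g
  proof -
    have "a \<in> Orbits.orbit g a"
      using that 0(1) by (intro permutation_self_in_orbit) (auto simp: permutation_permutes)
    then show ?thesis by (auto simp: card_Suc_eq)
  qed
  have fix_iff: "g permutes A \<and> g a = a \<longleftrightarrow> g permutes S" for g
  proof
    assume g: "g permutes A \<and> g a = a"
    show "g permutes S"
    proof (rule permutes_superset)
      show "g permutes insert a S" using g A(1) by simp
      show "\<And>x. x \<in> insert a S - S \<Longrightarrow> g x = x" using g by auto
    qed
  next
    assume g: "g permutes S"
    have "g a = a" by (rule permutes_not_in[OF g A(2)])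
    moreover have "g permutes A" unfolding A(1) by (rule permutes_imp_permutes_insert[OF g])
    ultimately show "g permutes A \<and> g a = a" by simp
  qed
  have eq: "{g. g permutes A \<and> card (Orbits.orbit g a) = Suc 0} = {g. g permutes S}"
    using orb fix_iff by (auto simp: orbit_eq_singleton_iff)
  have "(\<Sum>g | g permutes A \<and> card (Orbits.orbit g a) = Suc 0.
            F (A - Orbits.orbit g a) (perm_restrict g (A - Orbits.orbit g a)))
      = (\<Sum>g | g permutes S. F S g)"
    unfolding eq
  proof (rule sum.cong)
    fix g assume "g \<in> {g. g permutes S}"
    then have g: "g permutes S" by simp
    then have "Orbits.orbit g a = {a}"
      using permutes_not_in[OF g A(2)] by (simp add: orbit_eq_singleton_iff)
    then show "F (A - Orbits.orbit g a) (perm_restrict g (A - Orbits.orbit g a)) = F S g"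
      using g by (simp add: S_def[symmetric])
  qed simp
  also have "\<dots> = fact (card S) * perm_mean S (F S)"
    by (simp add: perm_mean_def)
  also have "perm_mean S (F S) = q"
    using 0(4)[of S] 0(1,2) by (auto simp: S_def)
  finally show ?case using 0(1,2) by (simp add: S_def)
next
  case (Suc j)
  define S where "S = A - {a}"
  have A: "A = insert a S" "a \<notin> S" "finite S" using Suc.prems by (auto simp: S_def)
  have cS: "card A = Suc (card S)" using A by simp
  let ?O = "Orbits.orbit"
  define G where "G = (\<lambda>g. if card (?O g a) = Suc (Suc j) then F (A - ?O g a) (perm_restrict g (A - ?O g a)) else 0)"
  define G' where "G' = (\<lambda>b h. if card (?O h b) = Suc j then F (S - ?O h b) (perm_restrict h (S - ?O h b)) else 0)"
  have fin: "finite {g. g permutes S}" "finite {g. g permutes A}"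
    using Suc.prems(1) A(3) by (auto intro: finite_permutations)
  \<comment> \<open>the composition with \<open>transpose a a\<close> fixes \<open>a\<close>, whereas here the cycle of \<open>a\<close> has at least two points\<close>
  have fixed: "G (transpose a a \<circ> h) = 0" if h: "h permutes S" for h
  proof -
    have "?O h a = {a}"
      using permutes_not_in[OF h A(2)] by (simp add: orbit_eq_singleton_iff)
    then show ?thesis by (simp add: G_def)
  qed
  have moved: "G (transpose a b \<circ> h) = G' b h" if h: "h permutes S" and b: "b \<in> S" for h b
  proof -
    have ab: "a \<noteq> b" using b A(2) by auto
    have ha: "h a = a" by (rule permutes_not_in[OF h A(2)])
    have ph: "permutation h" using h A(3) by (auto simp: permutation_permutes)
    have pg: "permutation (transpose a b \<circ> h)"
      using ph by (auto intro: permutation_compose permutation_swap_id)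
    have orb: "?O (transpose a b \<circ> h) a = insert a (?O h b)"
      by (rule orbit_transpose_comp[OF pg ha ab ph])
    have sub: "?O h b \<subseteq> S" by (rule permutes_orbit_subset[OF h b])
    then have card: "card (insert a (?O h b)) = Suc (card (?O h b))"
      using A by (intro card_insert_disjoint) (auto intro: finite_subset)
    have diff: "A - insert a (?O h b) = S - ?O h b" using sub A by auto
    have "h x \<noteq> a \<and> h x \<noteq> b" if "x \<in> S - ?O h b" for x
    proof -
      have "h x \<in> S" using that h by (simp add: permutes_in_image)
      moreover have "h x \<noteq> b"
      proof
        assume "h x = b"
        then have "b \<in> ?O h x" using Orbits.orbit.base[of h x] by simp
        then have "x \<in> ?O h b"
          using orbit_swap[OF permutation_self_in_orbit[OF ph, of x]] by simp
        with that show False by simp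
      qed
      ultimately show ?thesis using A(2) by auto
    qed
    then have "perm_restrict (transpose a b \<circ> h) (S - ?O h b) = perm_restrict h (S - ?O h b)"
      by (auto simp: fun_eq_iff perm_restrict_def)
    then show ?thesis by (simp add: G_def G'_def orb card diff)
  qed
  have "(\<Sum>g | g permutes A \<and> card (?O g a) = Suc (Suc j). F (A - ?O g a) (perm_restrict g (A - ?O g a)))
      = (\<Sum>g | g permutes A. G g)"
    unfolding G_def by (subst sum.inter_filter[symmetric]) (use fin in auto)
  also have "\<dots> = (\<Sum>b\<in>insert a S. \<Sum>h | h permutes S. G (transpose a b \<circ> h))"
    using sum_permutes_insert[OF A(3,2), of G] A(1) by simp
  also have "\<dots> = (\<Sum>b\<in>S. \<Sum>h | h permutes S. G (transpose a b \<circ> h))"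
    using A fixed by simp
  also have "\<dots> = (\<Sum>b\<in>S. \<Sum>h | h permutes S. G' b h)"
    using moved by (intro sum.cong) auto
  also have "\<dots> = (\<Sum>b\<in>S. fact (card S - 1) * q)"
  proof (rule sum.cong)
    fix b assume b: "b \<in> S"
    have "(\<Sum>h | h permutes S. G' b h)
      = (\<Sum>h | h permutes S \<and> card (?O h b) = Suc j. F (S - ?O h b) (perm_restrict h (S - ?O h b)))"
      unfolding G'_def by (subst sum.inter_filter[symmetric]) (use fin in auto)
    also have "\<dots> = fact (card S - 1) * q"
    proof (rule Suc.IH)
      fix B assume "B \<subseteq> S" "card B = card S - Suc j"
      then show "perm_mean B (F B) = q" using Suc.prems(4)[of B] A cS by auto
    qed (use A(3) b Suc.prems(3) cS in auto)
    finally show "(\<Sum>h | h permutes S. G' b h) = fact (card S - 1) * q" .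
  qed simp
  also have "\<dots> = fact (card A - 1) * q"
    using cS Suc.prems(3) by (simp add: fact_reduce)
  finally show ?case .
qed

text \<open>
  Every root \<open>x\<close> contributes \<open>fact (card A - 1) * q\<close>, so the \<open>card A\<close> roots together contribute
  \<open>fact (card A) * q\<close>. Points are counted, not cycles: a cycle of length \<open>j\<close> is met \<open>j\<close> times.
\<close>

theorem perm_mean_remove_cycle:
  fixes F :: "'a set \<Rightarrow> ('a \<Rightarrow> 'a) \<Rightarrow> real"
  assumes "finite A" "0 < j" "j \<le> card A"
    and "\<And>B. B \<subseteq> A \<Longrightarrow> card B = card A - j \<Longrightarrow> perm_mean B (F B) = q"
  shows "perm_mean A (\<lambda>g. \<Sum>x | x \<in> A \<and> card (Orbits.orbit g x) = j.
            F (A - Orbits.orbit g x) (perm_restrict g (A - Orbits.orbit g x))) = q"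
proof -
  obtain i where j: "j = Suc i" using assms(2) by (cases j) auto
  let ?O = "Orbits.orbit"
  define G where "G = (\<lambda>g x. if card (?O g x) = j then F (A - ?O g x) (perm_restrict g (A - ?O g x)) else 0)"
  have fin: "finite {g. g permutes A}" using assms(1) by (rule finite_permutations)
  have "(\<Sum>g | g permutes A. \<Sum>x | x \<in> A \<and> card (?O g x) = j. F (A - ?O g x) (perm_restrict g (A - ?O g x)))
      = (\<Sum>g | g permutes A. \<Sum>x\<in>A. G g x)"
    unfolding G_def by (intro sum.cong refl sum.inter_filter assms)
  also have "\<dots> = (\<Sum>x\<in>A. \<Sum>g | g permutes A. G g x)" by (rule sum.swap)
  also have "\<dots> = (\<Sum>x\<in>A. fact (card A - 1) * q)"
  proof (rule sum.cong)
    fix x assume x: "x \<in> A"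
    have "(\<Sum>g | g permutes A. G g x)
       = (\<Sum>g | g permutes A \<and> card (?O g x) = j. F (A - ?O g x) (perm_restrict g (A - ?O g x)))"
      unfolding G_def by (subst sum.inter_filter[symmetric]) (use fin in auto)
    also have "\<dots> = fact (card A - 1) * q"
      unfolding j by (rule sum_perms_rooted_cycle) (use assms x j in auto)
    finally show "(\<Sum>g | g permutes A. G g x) = fact (card A - 1) * q" .
  qed simp
  also have "\<dots> = fact (card A) * q"
    using assms(2,3) by (simp add: fact_reduce)
  finally show ?thesis by (simp add: perm_mean_def)
qed

section \<open>Cycle lengths in a prescribed set\<close>

definition cycles_in :: "nat set \<Rightarrow> 'a set \<Rightarrow> ('a \<Rightarrow> 'a) \<Rightarrow> 'a set set"
  where "cycles_in T A g = {C \<in> Orbits.orbit g ` A. card C \<in> T}"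

lemma orbit_eq_of_mem:
  assumes "permutation g" "y \<in> Orbits.orbit g x"
  shows "Orbits.orbit g y = Orbits.orbit g x"
  using orbit_cyclic_eq3[OF cyclic_on_orbit'[OF assms(1)] assms(2)] .

lemma orbit_perm_restrict:
  assumes g: "g permutes A" "finite A" and y: "y \<in> A - Orbits.orbit g x"
  shows "Orbits.orbit (perm_restrict g (A - Orbits.orbit g x)) y = Orbits.orbit g y"
proof (rule orbit_cong)
  have pg: "permutation g" using g by (auto simp: permutation_permutes)
  show "y \<in> Orbits.orbit g y" by (rule permutation_self_in_orbit[OF pg])
  fix z assume z: "z \<in> Orbits.orbit g y"
  have "z \<in> A" using permutes_orbit_subset[OF g(1)] y z by auto
  moreover have "z \<notin> Orbits.orbit g x"
    using orbit_eq_of_mem[OF pg z] orbit_eq_of_mem[OF pg, of z x] y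
      permutation_self_in_orbit[OF pg, of y] by auto
  ultimately show "perm_restrict g (A - Orbits.orbit g x) z = g z"
    by (simp add: perm_restrict_simps)
qed

lemma cycles_in_perm_restrict:
  assumes g: "g permutes A" "finite A" and x: "x \<in> A"
  shows "cycles_in T (A - Orbits.orbit g x) (perm_restrict g (A - Orbits.orbit g x))
    = cycles_in T A g - {Orbits.orbit g x}"
proof -
  have pg: "permutation g" using g by (auto simp: permutation_permutes)
  have eq: "Orbits.orbit g y = Orbits.orbit g x \<longleftrightarrow> y \<in> Orbits.orbit g x" for y
    using orbit_eq_of_mem[OF pg, of y x] permutation_self_in_orbit[OF pg, of y] by auto
  have "Orbits.orbit (perm_restrict g (A - Orbits.orbit g x)) ` (A - Orbits.orbit g x)
      = Orbits.orbit g ` (A - Orbits.orbit g x)"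
    by (intro image_cong refl orbit_perm_restrict g)
  also have "\<dots> = Orbits.orbit g ` A - {Orbits.orbit g x}"
    using eq by auto
  finally show ?thesis by (auto simp: cycles_in_def)
qed

text \<open>
  Passes from cycles to points, the form in which \<open>perm_mean_remove_cycle\<close> applies: a cycle of length
  \<open>t\<close> is counted once for each of its \<open>t\<close> points, which the weight \<open>1 / t\<close> compensates.
\<close>

lemma sum_over_cycles:
  fixes \<phi> :: "'a set \<Rightarrow> real"
  assumes g: "g permutes A" "finite A" and T: "finite T" "0 \<notin> T"
  shows "(\<Sum>C\<in>cycles_in T A g. \<phi> C)
    = (\<Sum>t\<in>T. 1 / real t * (\<Sum>x | x \<in> A \<and> card (Orbits.orbit g x) = t. \<phi> (Orbits.orbit g x)))"
proof -
  let ?O = "Orbits.orbit g"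
  have pg: "permutation g" using g by (auto simp: permutation_permutes)
  have fC: "finite (cycles_in T A g)" using g(2) by (simp add: cycles_in_def)
  have "(\<Sum>C\<in>cycles_in T A g. \<phi> C)
      = (\<Sum>C\<in>cycles_in T A g. \<Sum>x | x \<in> {x\<in>A. card (?O x) \<in> T} \<and> ?O x = C. \<phi> (?O x) / real (card (?O x)))"
  proof (rule sum.cong)
    fix C assume C: "C \<in> cycles_in T A g"
    then obtain x where x: "x \<in> A" "C = ?O x" "card C \<in> T" unfolding cycles_in_def by blast
    have mem: "y \<in> A \<and> ?O y = C \<longleftrightarrow> y \<in> C" for y
      using permutes_orbit_subset[OF g(1) x(1)] orbit_eq_of_mem[OF pg, of y x]
        permutation_self_in_orbit[OF pg, of y] unfolding x(2) by (metis subsetD)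
    have "{y. y \<in> {x\<in>A. card (?O x) \<in> T} \<and> ?O y = C} = {y. y \<in> A \<and> ?O y = C}"
      using x(3) by blast
    then have set: "{y. y \<in> {x\<in>A. card (?O x) \<in> T} \<and> ?O y = C} = C"
      unfolding mem by simp
    have C0: "card C \<noteq> 0" using x(3) T(2) by metis
    have "(\<Sum>y\<in>C. \<phi> (?O y) / real (card (?O y))) = (\<Sum>y\<in>C. \<phi> C / real (card C))"
    proof (rule sum.cong)
      fix y assume "y \<in> C"
      then have "?O y = C" using mem by blast
      then show "\<phi> (?O y) / real (card (?O y)) = \<phi> C / real (card C)" by simp
    qed simp
    also have "\<dots> = \<phi> C" using C0 by simp
    finally show "\<phi> C = (\<Sum>x | x \<in> {x\<in>A. card (?O x) \<in> T} \<and> ?O x = C. \<phi> (?O x) / real (card (?O x)))"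
      unfolding set by simp
  qed simp
  also have "\<dots> = (\<Sum>x\<in>{x\<in>A. card (?O x) \<in> T}. \<phi> (?O x) / real (card (?O x)))"
    by (rule sum.group) (use g(2) fC in \<open>auto simp: cycles_in_def\<close>)
  also have "\<dots> = (\<Sum>t\<in>T. \<Sum>x | x \<in> {x\<in>A. card (?O x) \<in> T} \<and> card (?O x) = t. \<phi> (?O x) / real (card (?O x)))"
    by (rule sum.group[symmetric]) (use g(2) T in auto)
  also have "\<dots> = (\<Sum>t\<in>T. 1 / real t * (\<Sum>x | x \<in> A \<and> card (?O x) = t. \<phi> (?O x)))"
    by (auto simp: sum_distrib_left intro!: sum.cong)
  finally show ?thesis .
qed

text \<open>
  The binomial moments of the number \<open>N\<close> of cycles with length in \<open>T\<close> are those of a Poisson variable.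
  Since \<open>(k + 1) * (N choose (k + 1)) = N * ((N - 1) choose k)\<close>, choosing \<open>k + 1\<close> cycles amounts to
  removing one cycle and choosing \<open>k\<close> of the remaining ones. The removed cycle, of length \<open>t\<close>, gives a
  factor \<open>1 / t\<close>, and the degree drops to \<open>card A - t\<close>; the condition \<open>k * y \<le> card A\<close> ensures that
  there is always room for the next cycle.
\<close>

theorem perm_mean_choose_cycles:
  fixes A :: "'a set"
  assumes "finite A" "finite T" "0 \<notin> T" "\<And>t. t \<in> T \<Longrightarrow> t \<le> y" "k * y \<le> card A"
  shows "perm_mean A (\<lambda>g. real (card (cycles_in T A g) choose k))
    = (\<Sum>t\<in>T. 1 / real t) ^ k / fact k"
  using assms(1,5)
proof (induction k arbitrary: A)
  case 0
  then show ?case by (simp add: perm_mean_const)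
next
  case (Suc k)
  let ?O = "Orbits.orbit" and ?H = "\<Sum>t\<in>T. 1 / real t"
  define F :: "'a set \<Rightarrow> ('a \<Rightarrow> 'a) \<Rightarrow> real"
    where "F = (\<lambda>B g. real (card (cycles_in T B g) choose k))"
  have "real (Suc k) * perm_mean A (\<lambda>g. real (card (cycles_in T A g) choose Suc k))
      = perm_mean A (\<lambda>g. real (Suc k) * real (card (cycles_in T A g) choose Suc k))"
    by (simp only: perm_mean_mult_left)
  also have "\<dots> = perm_mean A (\<lambda>g. \<Sum>t\<in>T. 1 / real t * (\<Sum>x | x \<in> A \<and> card (?O g x) = t.
      F (A - ?O g x) (perm_restrict g (A - ?O g x))))"
  proof (rule perm_mean_cong)
    fix g assume g: "g permutes A"
    let ?N = "card (cycles_in T A g)"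
    have fC: "finite (cycles_in T A g)" using Suc.prems(1) by (simp add: cycles_in_def)
    have "real (Suc k) * real (?N choose Suc k) = real (?N * ((?N - 1) choose k))"
      by (simp only: of_nat_mult[symmetric] binomial_absorption)
    also have "\<dots> = (\<Sum>C\<in>cycles_in T A g. real ((?N - 1) choose k))"
      by simp
    also have "\<dots> = (\<Sum>C\<in>cycles_in T A g. real (card (cycles_in T A g - {C}) choose k))"
      using fC by (intro sum.cong) auto
    also have "\<dots> = (\<Sum>t\<in>T. 1 / real t * (\<Sum>x | x \<in> A \<and> card (?O g x) = t.
        real (card (cycles_in T A g - {?O g x}) choose k)))"
      by (rule sum_over_cycles) (use g Suc.prems assms in auto)
    also have "\<dots> = (\<Sum>t\<in>T. 1 / real t * (\<Sum>x | x \<in> A \<and> card (?O g x) = t.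
        F (A - ?O g x) (perm_restrict g (A - ?O g x))))"
      using g Suc.prems(1) by (auto simp: F_def cycles_in_perm_restrict intro!: sum.cong)
    finally show "real (Suc k) * real (?N choose Suc k) = \<dots>" .
  qed
  also have "\<dots> = (\<Sum>t\<in>T. 1 / real t * (?H ^ k / fact k))"
    unfolding perm_mean_sum perm_mean_mult_left
  proof (rule sum.cong)
    fix t assume t: "t \<in> T"
    have ty: "t \<le> y" "0 < t" using assms(3,4) t by (auto intro: gr0I)
    have "perm_mean A (\<lambda>g. \<Sum>x | x \<in> A \<and> card (?O g x) = t.
        F (A - ?O g x) (perm_restrict g (A - ?O g x))) = ?H ^ k / fact k"
    proof (rule perm_mean_remove_cycle)
      show "t \<le> card A" using ty Suc.prems(2) by simp
      fix B assume B: "B \<subseteq> A" "card B = card A - t"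
      show "perm_mean B (F B) = ?H ^ k / fact k"
        unfolding F_def
        by (rule Suc.IH) (use B ty Suc.prems in \<open>auto intro: finite_subset\<close>)
    qed (use ty Suc.prems in auto)
    then show "1 / real t * perm_mean A (\<lambda>g. \<Sum>x | x \<in> A \<and> card (?O g x) = t.
        F (A - ?O g x) (perm_restrict g (A - ?O g x))) = 1 / real t * (?H ^ k / fact k)"
      by simp
  qed simp
  also have "\<dots> = ?H ^ Suc k / fact k"
    unfolding sum_distrib_right[symmetric] by simp
  finally have "perm_mean A (\<lambda>g. real (card (cycles_in T A g) choose Suc k))
      = ?H ^ Suc k / fact k / real (Suc k)"
    by (metis nonzero_mult_div_cancel_left of_nat_neq_0)
  then show ?case by (simp only: fact_Suc divide_divide_eq_left mult.commute)
qed

text \<open>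
  For \<open>N > 0\<close> the truncated alternating sum equals \<open>(N - 1) choose (2 * m)\<close>, which is nonnegative.
\<close>

lemma bonferroni_even:
  "(if N = 0 then 1 else 0) \<le> (\<Sum>k\<le>2*m. (-1) ^ k * real (N choose k))"
proof (cases N)
  case (Suc M)
  have "(\<Sum>k\<le>2*m. (-1) ^ k * real (N choose k)) = (real N - 1) gchoose (2*m)"
    using gbinomial_sum_lower_neg[of "real N" "2*m"] by (simp add: binomial_gbinomial mult.commute)
  also have "\<dots> = real (M choose (2*m))" by (simp add: Suc binomial_gbinomial)
  finally show ?thesis using Suc by simp
qed (simp add: sum.atMost_shift)

lemma power_div_fact_le_exp:
  fixes x :: real assumes "0 \<le> x"
  shows "x ^ k / fact k \<le> exp x"
proof -
  have "(\<Sum>i\<in>{k}. x ^ i /\<^sub>R fact i) \<le> exp x"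
    unfolding exp_def using assms
    by (intro sum_le_suminf summable_exp_generic) auto
  then show ?thesis by (simp add: divide_inverse mult.commute)
qed

text \<open>
  The terms of the exponential series at \<open>H\<close> decay geometrically once \<open>k\<close> exceeds \<open>3 * H\<close>: compare
  with the series at \<open>exp 1 * H\<close>, whose terms carry the additional factor \<open>exp k\<close>.
\<close>

lemma power_div_fact_le_exp_diff:
  fixes H :: real assumes "0 \<le> H"
  shows "H ^ k / fact k \<le> exp (3 * H - real k)"
proof -
  have "(exp 1 * H) ^ k / fact k \<le> exp (exp 1 * H)"
    using assms by (intro power_div_fact_le_exp) simp
  also have "exp (exp 1 * H) \<le> exp (3 * H)"
    using exp_le assms by (simp add: mult_right_mono)
  finally have "exp (real k) * (H ^ k / fact k) \<le> exp (3 * H)"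
    by (simp add: power_mult_distrib exp_of_nat_mult[symmetric])
  then show ?thesis by (simp add: exp_diff field_simps)
qed

text \<open>
  The Lagrange remainder is \<open>exp t\<close> times the next term of the series, at some \<open>t < 0\<close>, so
  the next term bounds its absolute value.
\<close>

lemma exp_neg_even_partial_sum:
  fixes H :: real assumes "0 \<le> H"
  shows "(\<Sum>k\<le>2*m. (-H) ^ k / fact k) \<le> exp (-H) + H ^ Suc (2*m) / fact (Suc (2*m))"
proof -
  have "\<exists>t. -H < t \<and> t < 0 \<and> exp (-H) = (\<Sum>i<Suc (2*m). exp 0 / fact i * (-H) ^ i)
      + exp t / fact (Suc (2*m)) * (-H) ^ Suc (2*m)" if "H > 0"
    by (rule Maclaurin_minus) (use that in \<open>auto intro!: derivative_eq_intros\<close>)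
  then show ?thesis
  proof (cases "H = 0")
    case False
    with assms \<open>H > 0 \<Longrightarrow> _\<close> obtain t where t: "t < 0"
      "exp (-H) = (\<Sum>i<Suc (2*m). exp 0 / fact i * (-H) ^ i)
        + exp t / fact (Suc (2*m)) * (-H) ^ Suc (2*m)" by auto
    have "exp t * (H ^ Suc (2*m) / fact (Suc (2*m))) \<le> 1 * (H ^ Suc (2*m) / fact (Suc (2*m)))"
      using t(1) assms by (intro mult_right_mono) auto
    moreover have odd: "(-H) ^ Suc (2*m) = - (H ^ Suc (2*m))" by (rule power_minus_odd) simp
    have "exp (-H) = (\<Sum>k\<le>2*m. (-H) ^ k / fact k) - exp t * (H ^ Suc (2*m) / fact (Suc (2*m)))"
      unfolding t(2) odd lessThan_Suc_atMost by (simp del: power_Suc fact_Suc)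
    ultimately show ?thesis by linarith
  qed (simp add: power_0_left sum.atMost_shift)
qed

theorem perm_mean_no_cycle_in:
  assumes "finite A" "finite T" "0 \<notin> T" "\<And>t. t \<in> T \<Longrightarrow> t \<le> y" "2 * m * y \<le> card A"
  defines "H \<equiv> \<Sum>t\<in>T. 1 / real t"
  shows "perm_mean A (\<lambda>g. if cycles_in T A g = {} then 1 else 0)
    \<le> exp (-H) + exp (3 * H - real (Suc (2*m)))"
proof -
  have H: "0 \<le> H" unfolding H_def by (intro sum_nonneg) auto
  have "perm_mean A (\<lambda>g. if cycles_in T A g = {} then 1 else 0)
      \<le> perm_mean A (\<lambda>g. \<Sum>k\<le>2*m. (-1) ^ k * real (card (cycles_in T A g) choose k))"
  proof (rule perm_mean_mono)
    fix g
    have "finite (cycles_in T A g)" using assms(1) by (simp add: cycles_in_def)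
    then show "(if cycles_in T A g = {} then 1 else 0) \<le> (\<Sum>k\<le>2*m. (-1) ^ k * real (card (cycles_in T A g) choose k))"
      using bonferroni_even[of "card (cycles_in T A g)" m] by simp
  qed
  also have "\<dots> = (\<Sum>k\<le>2*m. (-1) ^ k * (H ^ k / fact k))"
    unfolding perm_mean_sum perm_mean_mult_left H_def
  proof (intro sum.cong refl arg_cong2[where f = "(*)"] perm_mean_choose_cycles[where y = y] assms(1-3))
    show "t \<le> y" if "t \<in> T" for t using assms(4) that .
    fix k assume "k \<in> {..2*m}"
    then have "k * y \<le> 2 * m * y" by (intro mult_right_mono) auto
    with assms(5) show "k * y \<le> card A" by (rule order.trans[rotated])
  qed
  also have "\<dots> = (\<Sum>k\<le>2*m. (-H) ^ k / fact k)"
    by (simp add: power_minus[of H])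
  also have "\<dots> \<le> exp (-H) + H ^ Suc (2*m) / fact (Suc (2*m))"
    by (rule exp_neg_even_partial_sum[OF H])
  also have "\<dots> \<le> exp (-H) + exp (3 * H - real (Suc (2*m)))"
    using power_div_fact_le_exp_diff[OF H] by (rule add_left_mono)
  finally show ?thesis .
qed

text \<open>
  A random permutation has on average one point on cycles of length \<open>j\<close>, whatever \<open>j\<close> is
  (up to the degree): this is the removal of a cycle for the constant quantity 1.
\<close>

lemma perm_mean_points_on_cycles:
  fixes A :: "'a set"
  assumes "finite A" "0 < j"
  shows "perm_mean A (\<lambda>g. \<Sum>x | x \<in> A \<and> card (Orbits.orbit g x) = j. 1) = (if j \<le> card A then 1 else 0)"
proof (cases "j \<le> card A")
  case True
  have "perm_mean B (\<lambda>_. 1) = 1" if "B \<subseteq> A" for B :: "'a set"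
    using finite_subset[OF that assms(1)] by (rule perm_mean_const)
  then show ?thesis
    unfolding if_P[OF True]
    by (intro perm_mean_remove_cycle[where F = "\<lambda>_ _. 1"]) (use assms True in auto)
next
  case False
  have "perm_mean A (\<lambda>g. \<Sum>x | x \<in> A \<and> card (Orbits.orbit g x) = j. 1) = perm_mean A (\<lambda>_. 0)"
  proof (rule perm_mean_cong)
    fix g assume g: "g permutes A"
    have "card (Orbits.orbit g x) \<le> card A" if "x \<in> A" for x
      using permutes_orbit_subset[OF g that] assms(1) by (rule card_mono[rotated])
    then have "{x. x \<in> A \<and> card (Orbits.orbit g x) = j} = {}" using False by auto
    then show "(\<Sum>x | x \<in> A \<and> card (Orbits.orbit g x) = j. 1) = (0::real)" by (simp only: sum.empty)
  qed
  then show ?thesis using False assms by (simp add: perm_mean_const)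
qed

text \<open>
  A permutation with different cycles of lengths \<open>i\<close> and \<open>j\<close> has at least \<open>i * j\<close> pairs of points,
  one on each cycle. Removing the first cycle and then applying \<open>perm_mean_points_on_cycles\<close> to the
  rest shows that the average number of such pairs is 1 or, if the two cycles do not fit, 0.
\<close>

theorem perm_mean_two_cycles_le:
  assumes "finite A" "0 < i" "0 < j"
  shows "perm_mean A (\<lambda>g. if \<exists>x\<in>A. \<exists>y\<in>A. card (Orbits.orbit g x) = i \<and> card (Orbits.orbit g y) = j \<and>
            Orbits.orbit g x \<noteq> Orbits.orbit g y then 1 else 0) \<le> 1 / (real i * real j)"
proof -
  let ?O = "Orbits.orbit"
  define F :: "'a set \<Rightarrow> ('a \<Rightarrow> 'a) \<Rightarrow> real"
    where "F = (\<lambda>B g. \<Sum>y | y \<in> B \<and> card (?O g y) = j. 1)"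
  define S where "S = (\<lambda>g. \<Sum>x | x \<in> A \<and> card (?O g x) = i. F (A - ?O g x) (perm_restrict g (A - ?O g x)))"
  have F0: "F B g \<ge> 0" for B g unfolding F_def by (rule sum_nonneg) simp
  have "perm_mean A S \<le> 1"
  proof (cases "i \<le> card A")
    case True
    have "perm_mean A S = (if j \<le> card A - i then 1 else 0)"
      unfolding S_def
    proof (rule perm_mean_remove_cycle)
      fix B assume B: "B \<subseteq> A" "card B = card A - i"
      show "perm_mean B (F B) = (if j \<le> card A - i then 1 else 0)"
        unfolding F_def B(2)[symmetric]
        by (rule perm_mean_points_on_cycles) (use B assms in \<open>auto intro: finite_subset\<close>)
    qed (use True assms in auto)
    then show ?thesis by simp
  next
    case False
    have "perm_mean A S = perm_mean A (\<lambda>_. 0)"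
    proof (rule perm_mean_cong)
      fix g assume g: "g permutes A"
      have "card (?O g x) \<le> card A" if "x \<in> A" for x
        using permutes_orbit_subset[OF g that] assms(1) by (rule card_mono[rotated])
      then have "{x. x \<in> A \<and> card (?O g x) = i} = {}" using False by auto
      then show "S g = 0" unfolding S_def by (simp only: sum.empty)
    qed
    then show ?thesis using assms by (simp add: perm_mean_const)
  qed
  have "perm_mean A (\<lambda>g. if \<exists>x\<in>A. \<exists>y\<in>A. card (?O g x) = i \<and> card (?O g y) = j \<and> ?O g x \<noteq> ?O g y then 1 else 0)
      \<le> perm_mean A (\<lambda>g. 1 / (real i * real j) * S g)"
  proof (rule perm_mean_mono)
    fix g assume g: "g permutes A"
    have pg: "permutation g" using g assms(1) by (auto simp: permutation_permutes)
    show "(if \<exists>x\<in>A. \<exists>y\<in>A. card (?O g x) = i \<and> card (?O g y) = j \<and> ?O g x \<noteq> ?O g y then 1 else 0)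
        \<le> 1 / (real i * real j) * S g"
    proof (cases "\<exists>x\<in>A. \<exists>y\<in>A. card (?O g x) = i \<and> card (?O g y) = j \<and> ?O g x \<noteq> ?O g y")
      case True
      then obtain x y where xy: "x \<in> A" "y \<in> A" "card (?O g x) = i" "card (?O g y) = j" "?O g x \<noteq> ?O g y"
        by blast
      have sub: "?O g x \<subseteq> A" "?O g y \<subseteq> A" using permutes_orbit_subset[OF g] xy by auto
      have eqx: "?O g z = ?O g x" if "z \<in> ?O g x" for z by (rule orbit_eq_of_mem[OF pg that])
      have eqy: "?O g z = ?O g y" if "z \<in> ?O g y" for z by (rule orbit_eq_of_mem[OF pg that])
      have Fj: "real j \<le> F (A - ?O g z) (perm_restrict g (A - ?O g z))" if z: "z \<in> ?O g x" for z
      proof -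
        have "?O g y \<subseteq> {w. w \<in> A - ?O g z \<and> card (?O (perm_restrict g (A - ?O g z)) w) = j}"
        proof
          fix w assume w: "w \<in> ?O g y"
          have "w \<in> A - ?O g z"
            using w sub eqx[OF z] eqx[of w] eqy[OF w] xy(5) by auto
          with orbit_perm_restrict[OF g assms(1) this] eqy[OF w] xy(4)
          show "w \<in> {w. w \<in> A - ?O g z \<and> card (?O (perm_restrict g (A - ?O g z)) w) = j}" by simp
        qed
        then have "card (?O g y) \<le> card {w. w \<in> A - ?O g z \<and> card (?O (perm_restrict g (A - ?O g z)) w) = j}"
          by (rule card_mono[rotated]) (use assms(1) in auto)
        then show ?thesis using xy(4) by (simp add: F_def)
      qed
      have "real i * real j = (\<Sum>z\<in>?O g x. real j)" using xy(3) by simp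
      also have "\<dots> \<le> (\<Sum>z\<in>?O g x. F (A - ?O g z) (perm_restrict g (A - ?O g z)))"
        by (rule sum_mono) (rule Fj)
      also have "\<dots> \<le> S g"
        unfolding S_def
        by (rule sum_mono2) (use assms(1) sub F0 eqx xy(3) in auto)
      finally have "1 \<le> 1 / (real i * real j) * S g" using assms by (simp add: field_simps)
      with True show ?thesis by simp
    next
      case False
      have "0 \<le> S g" unfolding S_def by (intro sum_nonneg F0)
      then show ?thesis unfolding if_not_P[OF False] by simp
    qed
  qed
  also have "\<dots> \<le> 1 / (real i * real j)"
    unfolding perm_mean_mult_left using \<open>perm_mean A S \<le> 1\<close> assms
    by (simp add: divide_right_mono)
  finally show ?thesis .
qed

section \<open>A lower bound for sums of reciprocals of primes\<close>

lemma multiplicity_fact_eq_sum: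
  fixes p :: nat assumes "prime p"
  shows "multiplicity p (fact n) = (\<Sum>m\<in>{1..n}. multiplicity p m)"
  unfolding fact_prod of_nat_id
  by (rule prime_elem_multiplicity_prod_distrib) (use assms in auto)

text \<open>
  Legendre's formula in recursive form: only the multiples of \<open>p\<close> contribute, and dividing each of them
  by \<open>p\<close> leaves the factors of \<open>fact (n div p)\<close>.
\<close>

lemma multiplicity_fact_rec:
  fixes p :: nat assumes p: "prime p"
  shows "multiplicity p (fact n) = n div p + multiplicity p (fact (n div p))"
proof -
  have p0: "p > 0" using p prime_gt_0_nat by blast
  have inj: "inj_on ((*) p) {1..n div p}" using p0 by (auto intro: inj_onI)
  have sub: "(*) p ` {1..n div p} \<subseteq> {1..n}"
  proof (rule image_subsetI)
    fix x assume x: "x \<in> {1..n div p}"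
    then have "p * x \<le> n"
      using p0 by (simp add: less_eq_div_iff_mult_less_eq mult.commute)
    then show "p * x \<in> {1..n}" using p0 x by simp
  qed
  have "(\<Sum>m\<in>{1..n}. multiplicity p m) = (\<Sum>m\<in>(*) p ` {1..n div p}. multiplicity p m)"
  proof (rule sum.mono_neutral_right)
    show "\<forall>i\<in>{1..n} - (*) p ` {1..n div p}. multiplicity p i = 0"
    proof
      fix i assume i: "i \<in> {1..n} - (*) p ` {1..n div p}"
      have "\<not> p dvd i"
      proof
        assume "p dvd i"
        then obtain x where x: "i = p * x" by (auto elim: dvdE)
        then have "x \<in> {1..n div p}" using i p0
          by (auto simp: less_eq_div_iff_mult_less_eq mult.commute Suc_le_eq)
        with i x show False by blast
      qed
      then show "multiplicity p i = 0" by (rule not_dvd_imp_multiplicity_0)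
    qed
  qed (use sub in auto)
  also have "\<dots> = (\<Sum>m\<in>{1..n div p}. multiplicity p (p * m))"
    by (simp only: sum.reindex[OF inj] o_def)
  also have "\<dots> = (\<Sum>m\<in>{1..n div p}. 1 + multiplicity p m)"
    using p by (intro sum.cong refl) (subst multiplicity_times_same, auto)
  also have "\<dots> = n div p + (\<Sum>m\<in>{1..n div p}. multiplicity p m)"
    by (subst sum.distrib) simp
  finally show ?thesis by (simp only: multiplicity_fact_eq_sum[OF p])
qed

lemma multiplicity_fact_le:
  fixes p :: nat assumes p: "prime p"
  shows "(p - 1) * multiplicity p (fact n) \<le> n"
proof (induction n rule: less_induct)
  case (less n)
  show ?case
  proof (cases "n = 0")
    case False
    have p1: "p > 1" using p prime_gt_1_nat by blast
    then have "n div p < n" using False by simp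
    then have "(p - 1) * multiplicity p (fact n) \<le> (p - 1) * (n div p) + n div p"
      using less.IH[of "n div p"] by (subst multiplicity_fact_rec[OF p]) (simp add: distrib_left)
    also have "\<dots> = p * (n div p)" using p1 by (cases p) auto
    also have "\<dots> \<le> n" by simp
    finally show ?thesis .
  qed simp
qed

text \<open>
  The first term \<open>n div p\<close> of Legendre's formula alone is at least \<open>(n - 1) / (2 * (p - 1))\<close>, the
  extreme case being \<open>n = 2 * p - 1\<close>. The factor 2 lost against \<open>multiplicity_fact_le\<close> is the source of
  the constant 1 in \<open>sum_prime_reciprocals_ge\<close>.
\<close>

lemma multiplicity_fact_ge:
  fixes p :: nat assumes p: "prime p" "p \<le> n"
  shows "n - 1 \<le> 2 * (p - 1) * multiplicity p (fact n)"
proof -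
  have p1: "p \<ge> 2" using p prime_ge_2_nat by blast
  define q where "q = n div p"
  have q: "q \<ge> 1" using p p1 by (simp add: q_def Suc_le_eq div_greater_zero_iff)
  have "n = p * q + n mod p" by (simp add: q_def)
  moreover have "n mod p < p" using p1 by simp
  ultimately have "n - 1 \<le> p * q + (p - 2)" using p1 by linarith
  also have "p - 2 \<le> (p - 2) * q" using q by simp
  also have "p * q + (p - 2) * q = 2 * (p - 1) * q"
  proof -
    obtain r where "p = 2 + r" using p1 le_Suc_ex by blast
    then show ?thesis by (simp add: algebra_simps)
  qed
  also have "\<dots> \<le> 2 * (p - 1) * multiplicity p (fact n)"
    by (subst multiplicity_fact_rec[OF p(1)]) (simp add: q_def)
  finally show ?thesis by simp
qed

lemma ln_fact_eq_sum_primes: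
  "ln (fact n) = (\<Sum>p | prime p \<and> p \<le> n. real (multiplicity p (fact n :: nat)) * ln (real p))"
proof -
  have "(fact n :: real) = real (fact n)" by simp
  also have "fact n = (\<Prod>p\<in>prime_factors (fact n). p ^ multiplicity p (fact n :: nat))"
    by (rule prime_factorization_nat) simp
  also have "prime_factors (fact n :: nat) = {p. prime p \<and> p \<le> n}"
    by (auto simp: in_prime_factors_iff prime_dvd_fact_iff)
  finally have "ln (fact n) = ln (\<Prod>p | prime p \<and> p \<le> n. real p ^ multiplicity p (fact n :: nat))"
    by simp
  also have "\<dots> = (\<Sum>p | prime p \<and> p \<le> n. ln (real p ^ multiplicity p (fact n :: nat)))"
    by (rule ln_prod) (auto dest: prime_gt_0_nat)
  also have "\<dots> = (\<Sum>p | prime p \<and> p \<le> n. real (multiplicity p (fact n :: nat)) * ln (real p))"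
    by (intro sum.cong refl ln_realpow)
  finally show ?thesis .
qed

text \<open>
  The sum in Mertens' first theorem, with denominators \<open>p - 1\<close> in place of \<open>p\<close>. These are the ones
  that Legendre's formula produces, because \<open>n / (p - 1)\<close> is the sum of \<open>n / p ^ k\<close> over \<open>k \<ge> 1\<close>; so
  higher prime powers need no separate treatment.
\<close>

definition prime_log_sum :: "nat \<Rightarrow> real"
  where "prime_log_sum n = (\<Sum>p | prime p \<and> p \<le> n. ln (real p) / (real p - 1))"

text \<open>
  As \<open>n ^ n / fact n\<close> is a term of the series for \<open>exp n\<close>, it is at most \<open>exp n\<close>. The lemma
  compares the resulting bound \<open>ln (fact n) \<ge> n * ln n - n\<close> with the factorisation of \<open>fact n\<close>.
\<close>

lemma prime_log_sum_ge:
  assumes "n > 0"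
  shows "ln (real n) - 1 \<le> prime_log_sum n"
proof -
  have "real n ^ n / fact n \<le> exp (real n)" by (rule power_div_fact_le_exp) simp
  then have "ln (real n ^ n / fact n) \<le> ln (exp (real n))" using assms by (subst ln_le_cancel_iff) auto
  then have "real n * ln (real n) - real n \<le> ln (fact n)"
    using assms by (simp add: ln_div ln_realpow)
  also have "\<dots> \<le> (\<Sum>p | prime p \<and> p \<le> n. real n * (ln (real p) / (real p - 1)))"
    unfolding ln_fact_eq_sum_primes
  proof (rule sum_mono)
    fix p assume "p \<in> {p. prime p \<and> p \<le> n}"
    then have p: "prime p" "p > 1" using prime_gt_1_nat by auto
    have "real ((p - 1) * multiplicity p (fact n :: nat)) \<le> real n"
      using multiplicity_fact_le[OF p(1)] of_nat_mono by blast
    then have "real (multiplicity p (fact n :: nat)) \<le> real n / (real p - 1)"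
      using p(2) by (simp add: of_nat_diff field_simps)
    then have "real (multiplicity p (fact n :: nat)) * ln (real p) \<le> real n / (real p - 1) * ln (real p)"
      using p(2) by (intro mult_right_mono) auto
    then show "real (multiplicity p (fact n :: nat)) * ln (real p) \<le> real n * (ln (real p) / (real p - 1))" by simp
  qed
  also have "\<dots> = real n * prime_log_sum n" by (simp add: prime_log_sum_def sum_distrib_left)
  finally have "real n * (ln (real n) - 1) \<le> real n * prime_log_sum n" by (simp add: algebra_simps)
  then show ?thesis using assms by simp
qed

lemma prime_log_sum_le:
  assumes "n > 1"
  shows "prime_log_sum n \<le> 2 * (real n / (real n - 1)) * ln (real n)"
proof -
  have "(real n - 1) / 2 * prime_log_sum n = (\<Sum>p | prime p \<and> p \<le> n. (real n - 1) / 2 * (ln (real p) / (real p - 1)))"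
    by (simp add: prime_log_sum_def sum_distrib_left)
  also have "\<dots> \<le> ln (fact n)"
    unfolding ln_fact_eq_sum_primes
  proof (rule sum_mono)
    fix p assume "p \<in> {p. prime p \<and> p \<le> n}"
    then have p: "prime p" "p > 1" "p \<le> n" using prime_gt_1_nat by auto
    have "real (n - 1) \<le> real (2 * (p - 1) * multiplicity p (fact n :: nat))"
      using multiplicity_fact_ge[OF p(1,3)] of_nat_mono by blast
    then have "(real n - 1) / 2 / (real p - 1) \<le> real (multiplicity p (fact n :: nat))"
      using p(2) assms by (simp add: of_nat_diff field_simps)
    then have "(real n - 1) / 2 / (real p - 1) * ln (real p) \<le> real (multiplicity p (fact n :: nat)) * ln (real p)"
      using p(2) by (intro mult_right_mono) auto
    then show "(real n - 1) / 2 * (ln (real p) / (real p - 1)) \<le> real (multiplicity p (fact n :: nat)) * ln (real p)"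
      by simp
  qed
  also have "ln (fact n) \<le> ln (real n ^ n)"
  proof (subst ln_le_cancel_iff)
    have "(fact n :: nat) \<le> n ^ n"
    proof (induction n)
      case (Suc n)
      have "(fact (Suc n) :: nat) \<le> Suc n * n ^ n"
        using mult_left_mono[OF Suc, of "Suc n"] by simp
      also have "\<dots> \<le> Suc n * Suc n ^ n" by (intro mult_left_mono power_mono) auto
      finally show ?case by simp
    qed simp
    then have "real (fact n) \<le> real (n ^ n)" by (simp only: of_nat_le_iff)
    then show "fact n \<le> real n ^ n" by simp
  qed (use assms in auto)
  also have "\<dots> = real n * ln (real n)" using assms by (simp add: ln_realpow)
  finally show ?thesis using assms by (simp add: field_simps)
qed

text \<open>
  Partial summation in the form of an induction on \<open>b\<close>. Passing from \<open>m\<close> to \<open>m + 1\<close> brings in the term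
  \<open>prime_log_sum m * (1 / ln m - 1 / ln (m + 1))\<close>. By \<open>prime_log_sum m \<ge> ln (m + 1) - 2\<close> it is at
  least \<open>ln (m + 1) / ln m - 1\<close> up to a telescoping error, and \<open>x - 1 \<ge> ln x\<close> turns this into a
  difference of values of \<open>ln (ln m)\<close>. Comparing with \<open>ln (m + 1)\<close> rather than with \<open>ln m\<close> is what
  makes this last inequality point the right way.
\<close>

lemma sum_prime_reciprocals_shifted_ge:
  assumes "2 \<le> a" "a \<le> b"
  shows "prime_log_sum b / ln (real b) - prime_log_sum a / ln (real a)
      + ln (ln (real b)) - ln (ln (real a)) - 2 * (1 / ln (real a) - 1 / ln (real b))
    \<le> (\<Sum>p | prime p \<and> a < p \<and> p \<le> b. 1 / (real p - 1))"
  using assms(2)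
proof (induction b rule: dec_induct)
  case base
  have "{p. prime p \<and> a < p \<and> p \<le> a} = {}" by auto
  then show ?case by (simp only: sum.empty) simp
next
  case (step m)
  let ?W = "\<lambda>b. \<Sum>p | prime p \<and> a < p \<and> p \<le> b. 1 / (real p - 1)"
  define l l' where "l = ln (real m)" and "l' = ln (real (Suc m))"
  have m: "m \<ge> 2" using step(1) assms(1) by simp
  have l: "0 < l" "0 < l'" "l \<le> l'" using m by (auto simp: l_def l'_def)
  have stepS: "prime_log_sum (Suc m) = prime_log_sum m + (if prime (Suc m) then l' / real m else 0)"
  proof -
    have "{p. prime p \<and> p \<le> Suc m} = (if prime (Suc m) then insert (Suc m) {p. prime p \<and> p \<le> m} else {p. prime p \<and> p \<le> m})"
      by (auto simp: le_Suc_eq)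
    then show ?thesis by (auto simp: prime_log_sum_def l'_def)
  qed
  have stepW: "?W (Suc m) = ?W m + (if prime (Suc m) then 1 / real m else 0)"
  proof -
    have "{p. prime p \<and> a < p \<and> p \<le> Suc m}
      = (if prime (Suc m) then insert (Suc m) {p. prime p \<and> a < p \<and> p \<le> m} else {p. prime p \<and> a < p \<and> p \<le> m})"
      using step(1) by (auto simp: le_Suc_eq)
    then show ?thesis by auto
  qed
  have W: "?W (Suc m) = ?W m + (prime_log_sum (Suc m) - prime_log_sum m) / l'"
    unfolding stepS stepW using l by simp
  \<comment> \<open>consecutive logarithms differ by at most 1, so \<open>prime_log_sum m \<ge> l - 1\<close> also gives \<open>prime_log_sum m \<ge> l' - 2\<close>\<close>
  have "l' - l = ln (real (Suc m) / real m)" using m by (simp add: l_def l'_def ln_div)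
  also have "\<dots> \<le> real (Suc m) / real m - 1" using m by (intro ln_le_minus_one) simp
  also have "\<dots> \<le> 1" using m by (simp add: field_simps)
  finally have "l' - 2 \<le> prime_log_sum m"
    using prime_log_sum_ge[of m] m by (simp add: l_def)
  then have "(l' - 2) * (1 / l - 1 / l') \<le> prime_log_sum m * (1 / l - 1 / l')"
    using l by (intro mult_right_mono) (auto simp: field_simps)
  moreover have "(l' - 2) * (1 / l - 1 / l') = l' / l - 1 - 2 * (1 / l - 1 / l')"
    using l by (simp add: field_simps)
  moreover have "ln l' - ln l \<le> l' / l - 1"
    using ln_le_minus_one[of "l' / l"] l by (simp add: ln_div)
  ultimately have "ln l' - ln l - 2 * (1 / l - 1 / l') \<le> prime_log_sum m / l - prime_log_sum m / l'"
    by (simp add: right_diff_distrib)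
  then show ?case using step.IH unfolding W l_def[symmetric] l'_def[symmetric]
    by (simp add: diff_divide_distrib)
qed

lemma sum_reciprocal_consecutive_le:
  assumes "0 < a" "\<And>m. m \<in> M \<Longrightarrow> a < m \<and> m \<le> b"
  shows "(\<Sum>m\<in>M. 1 / (real m * (real m - 1))) \<le> 1 / real a"
proof -
  have "(\<Sum>m\<in>M. 1 / (real m * (real m - 1))) \<le> (\<Sum>m\<in>{Suc a..b}. 1 / (real m * (real m - 1)))"
    by (rule sum_mono2) (use assms in \<open>auto simp: Suc_le_eq\<close>)
  also have "\<dots> \<le> 1 / real a"
  proof (cases "a \<le> b")
    case True
    then have "(\<Sum>m\<in>{Suc a..b}. 1 / (real m * (real m - 1))) = 1 / real a - 1 / real b"
    proof (induction b rule: dec_induct)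
      case (step n)
      have "1 / (real (Suc n) * (real (Suc n) - 1)) = 1 / real n - 1 / real (Suc n)"
        using assms(1) step(1) by (simp add: field_simps)
      then show ?case using step by simp
    qed simp
    then show ?thesis by simp
  qed simp
  finally show ?thesis .
qed

text \<open>
  In \<open>sum_prime_reciprocals_shifted_ge\<close> the boundary term at \<open>b\<close> is at least \<open>1 - o(1)\<close>
  and the one at \<open>a\<close> at most \<open>2 + o(1)\<close>; their difference gives the constant \<open>-1\<close>. Replacing \<open>p - 1\<close> by \<open>p\<close> costs at
  most \<open>1 / a\<close>, by telescoping.
\<close>

theorem sum_prime_reciprocals_ge:
  assumes "2 \<le> a" "a \<le> b"
  shows "ln (ln (real b)) - ln (ln (real a)) - 1 - (2 / ln (real a) + 3 / (real a - 1))
    \<le> (\<Sum>p | prime p \<and> a < p \<and> p \<le> b. 1 / real p)"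
proof -
  let ?T = "{p. prime p \<and> a < p \<and> p \<le> b}"
  have pos: "ln (real a) > 0" "ln (real b) > 0" using assms by auto
  have "prime_log_sum a / ln (real a) \<le> 2 * (real a / (real a - 1))"
    using prime_log_sum_le[of a] assms pos by (simp add: field_simps)
  also have "\<dots> = 2 + 2 / (real a - 1)" using assms by (simp add: field_simps)
  finally have Sa: "prime_log_sum a / ln (real a) \<le> 2 + 2 / (real a - 1)" .
  have "(ln (real b) - 1) / ln (real b) \<le> prime_log_sum b / ln (real b)"
    using prime_log_sum_ge[of b] assms pos by (intro divide_right_mono) auto
  then have Sb: "1 - 1 / ln (real b) \<le> prime_log_sum b / ln (real b)"
    using pos by (simp add: diff_divide_distrib)
  have "(\<Sum>p\<in>?T. 1 / real p) = (\<Sum>p\<in>?T. 1 / (real p - 1)) - (\<Sum>p\<in>?T. 1 / (real p * (real p - 1)))"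
    unfolding sum_subtractf[symmetric]
  proof (rule sum.cong)
    fix p assume "p \<in> ?T"
    then have "real p > 1" using prime_gt_1_nat by simp
    then have "1 / (real p - 1) - 1 / (real p * (real p - 1)) = (real p - 1) / (real p * (real p - 1))"
      by (simp add: diff_divide_distrib)
    then show "1 / real p = 1 / (real p - 1) - 1 / (real p * (real p - 1))"
      using \<open>real p > 1\<close> by simp
  qed simp
  moreover have "(\<Sum>p\<in>?T. 1 / (real p * (real p - 1))) \<le> 1 / real a"
    by (rule sum_reciprocal_consecutive_le[where b = b]) (use assms in auto)
  moreover have "1 / real a \<le> 1 / (real a - 1)" using assms by (simp add: frac_le)
  moreover have "0 < 1 / ln (real b)" using pos by simp
  moreover have "2 / (real a - 1) + 1 / (real a - 1) = 3 / (real a - 1)"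
    by (simp add: add_divide_distrib[symmetric])
  moreover have "2 * (1 / ln (real a) - 1 / ln (real b)) = 2 / ln (real a) - 2 * (1 / ln (real b))"
    by (simp add: right_diff_distrib)
  ultimately show ?thesis
    using sum_prime_reciprocals_shifted_ge[OF assms] Sa Sb by linarith
qed

section \<open>Powers that are cycles of prime length\<close>

lemma funpow_card_orbit:
  assumes "permutation g"
  shows "(g ^^ card (Orbits.orbit g x)) x = x"
proof -
  have x: "x \<in> Orbits.orbit g x" by (rule permutation_self_in_orbit[OF assms])
  have "card (Orbits.orbit g x) = funpow_dist1 g x x"
    unfolding orbit_conv_funpow_dist1[OF x]
    by (simp only: card_image[OF inj_on_funpow_dist1[OF x]] card_atLeastLessThan diff_zero)
  then show ?thesis using funpow_dist1_prop[OF x] by (simp only:)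
qed

lemma funpow_eq_self_of_card_orbit_dvd:
  assumes "permutation g" "card (Orbits.orbit g x) dvd m"
  shows "(g ^^ m) x = x"
  using funpow_mod_eq[OF funpow_card_orbit[OF assms(1), of x], of m] assms(2) by simp

text \<open>
  If \<open>m * k\<close> is 1 modulo the length of the cycle, then on the cycle \<open>g\<close> is the \<open>k\<close>-th power of
  \<open>g ^^ m\<close>, so the two permutations have the same orbit there.
\<close>

lemma orbit_funpow_coprime:
  assumes g: "permutation g" and co: "coprime m (card (Orbits.orbit g x))"
  shows "Orbits.orbit (g ^^ m) x = Orbits.orbit g x"
proof (intro equalityI subsetI)
  fix z assume "z \<in> Orbits.orbit (g ^^ m) x"
  then show "z \<in> Orbits.orbit g x"
    by induction (auto intro: funpow_in_orbit permutation_self_in_orbit[OF g])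
next
  let ?c = "card (Orbits.orbit g x)"
  obtain k where k: "[m * k = 1] (mod ?c)" using cong_solve_coprime_nat[OF co] by auto
  have pow: "g z = ((g ^^ m) ^^ k) z" if z: "z \<in> Orbits.orbit g x" for z
  proof -
    have fix_z: "(g ^^ ?c) z = z"
      using funpow_card_orbit[OF g, of z] orbit_eq_of_mem[OF g z] by simp
    have "((g ^^ m) ^^ k) z = (g ^^ (m * k)) z" by (simp add: funpow_mult)
    also have "\<dots> = (g ^^ (m * k mod ?c)) z" by (rule funpow_mod_eq[OF fix_z, symmetric])
    also have "\<dots> = (g ^^ (1 mod ?c)) z" using k unfolding Cong.cong_def by (simp only:)
    also have "\<dots> = (g ^^ 1) z" by (rule funpow_mod_eq[OF fix_z])
    finally show ?thesis by simp
  qed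
  have h: "permutation (g ^^ m)" using g by (rule permutation_funpow)
  have x: "x \<in> Orbits.orbit g x" by (rule permutation_self_in_orbit[OF g])
  fix z assume "z \<in> Orbits.orbit g x"
  then show "z \<in> Orbits.orbit (g ^^ m) x"
  proof induction
    case base
    show ?case unfolding pow[OF x] by (intro funpow_in_orbit permutation_self_in_orbit[OF h])
  next
    case (step y)
    show ?case unfolding pow[OF step.hyps] by (rule funpow_in_orbit[OF step.IH])
  qed
qed

text \<open>
  The exponent is the product of the lengths of the other cycles. It is a multiple of each of them and,
  \<open>p\<close> being prime, coprime to \<open>p\<close>.
\<close>

lemma power_is_prime_cycle:
  assumes g: "g permutes A" "finite A" and x: "x \<in> A" and p: "prime p" "card (Orbits.orbit g x) = p"
    and other: "\<And>y. y \<in> A \<Longrightarrow> Orbits.orbit g y \<noteq> Orbits.orbit g x \<Longrightarrow> \<not> p dvd card (Orbits.orbit g y)"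
  shows "\<exists>m. is_cycle_perm p (g ^^ m)"
proof
  let ?O = "Orbits.orbit g"
  define m where "m = (\<Prod>C\<in>?O ` A - {?O x}. card C)"
  let ?h = "g ^^ m"
  have pg: "permutation g" using g by (auto simp: permutation_permutes)
  have "\<not> p dvd m"
    unfolding m_def using g(2) other p(1) by (subst prime_dvd_prod_iff) auto
  then have co: "coprime m p"
    using p(1) by (metis coprime_commute prime_imp_coprime)
  have on_cycle: "Orbits.orbit ?h y = ?O x" if y: "y \<in> ?O x" for y
    using orbit_funpow_coprime[OF pg, of m y] orbit_eq_of_mem[OF pg y] co p(2) by simp
  have off_cycle: "Orbits.orbit ?h y = {y}" if y: "y \<notin> ?O x" for y
  proof -
    have "?h y = y"
    proof (cases "y \<in> A")
      case True
      have "?O y \<noteq> ?O x" using y permutation_self_in_orbit[OF pg, of y] by auto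
      then have "card (?O y) dvd m"
        unfolding m_def using True g(2) by (intro dvd_prodI) auto
      then show ?thesis by (rule funpow_eq_self_of_card_orbit_dvd[OF pg])
    next
      case False
      then have "g y = y" by (rule permutes_not_in[OF g(1)])
      then show ?thesis by (induction m) auto
    qed
    then show ?thesis by (simp add: orbit_eq_singleton_iff)
  qed
  have "{D \<in> range (Orbits.orbit ?h). 1 < card D} = {?O x}"
  proof (intro equalityI subsetI)
    fix D assume "D \<in> {D \<in> range (Orbits.orbit ?h). 1 < card D}"
    then obtain y where "D = Orbits.orbit ?h y" "1 < card D" by blast
    then show "D \<in> {?O x}" using on_cycle[of y] off_cycle[of y] by (cases "y \<in> ?O x") auto
  next
    fix D assume "D \<in> {?O x}"
    then have "D = Orbits.orbit ?h x" using on_cycle[OF permutation_self_in_orbit[OF pg]] by simp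
    moreover have "1 < card D" using \<open>D \<in> {?O x}\<close> p prime_gt_1_nat by auto
    ultimately show "D \<in> {D \<in> range (Orbits.orbit ?h). 1 < card D}" by blast
  qed
  then show "is_cycle_perm p ?h"
    unfolding is_cycle_perm_def using permutation_funpow[OF pg] p(2) by blast
qed

section \<open>The proportion of failures\<close>

lemma sum_reciprocals_le:
  assumes "n > 0"
  shows "(\<Sum>k\<in>{1..n}. 1 / real k) \<le> 1 + ln (real n)"
  using assms
proof (induction n rule: nat_induct_non_zero)
  case (Suc n)
  have "ln (real n / real (Suc n)) \<le> real n / real (Suc n) - 1"
    using Suc.hyps by (intro ln_le_minus_one) simp
  then have "1 / real (Suc n) \<le> ln (real (Suc n)) - ln (real n)"
    using Suc.hyps by (simp add: ln_div field_simps)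
  then show ?case using Suc.IH by simp
qed simp

text \<open>
  The union bound over the two kinds of failure. Bonferroni's inequality is truncated after
  the term of index \<open>2 * m\<close>.
\<close>

lemma perm_mean_not_prime_cycle_power_le:
  fixes a b m n :: nat
  assumes n: "0 < n" and a: "0 < a" "ln (real n) \<le> real a"
    and b: "real b < ln (real n) powr ln (ln (real n))" "2 * m * b \<le> n"
  defines "H \<equiv> \<Sum>p | prime p \<and> a < p \<and> p \<le> b. 1 / real p"
  shows "perm_mean {1..n} (\<lambda>g. if prime_cycle_power n g then 0 else 1)
    \<le> exp (-H) + exp (3 * H - real (Suc (2*m))) + (1 + ln (real n)) / real a"
proof -
  let ?A = "{1..n}" and ?O = "Orbits.orbit"
  define T where "T = {p. prime p \<and> a < p \<and> p \<le> b}"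
  have T: "finite T" "0 \<notin> T" unfolding T_def by (auto intro: finite_subset[of _ "{..b}"])
  define E where "E = (\<lambda>i j (g :: nat \<Rightarrow> nat). if \<exists>x\<in>?A. \<exists>y\<in>?A. card (?O g x) = i \<and> card (?O g y) = j \<and> ?O g x \<noteq> ?O g y
    then 1 else 0 :: real)"
  define Z where "Z = (\<lambda>g :: nat \<Rightarrow> nat. if cycles_in T ?A g = {} then 1 else 0 :: real)"
  have E0: "0 \<le> E i j g" for i j g by (simp add: E_def)
  have "perm_mean ?A (\<lambda>g. if prime_cycle_power n g then 0 else 1)
      \<le> perm_mean ?A (\<lambda>g. Z g + (\<Sum>p\<in>T. \<Sum>k\<in>{1..n}. E p (p * k) g))"
  proof (rule perm_mean_mono)
    fix g assume g: "g permutes ?A"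
    have sum0: "0 \<le> (\<Sum>p\<in>T. \<Sum>k\<in>{1..n}. E p (p * k) g)" by (intro sum_nonneg E0)
    consider "prime_cycle_power n g" | "cycles_in T ?A g = {}"
      | "\<not> prime_cycle_power n g" "cycles_in T ?A g \<noteq> {}" by blast
    then show "(if prime_cycle_power n g then 0 else 1) \<le> Z g + (\<Sum>p\<in>T. \<Sum>k\<in>{1..n}. E p (p * k) g)"
    proof cases
      case 3
      then obtain x where x: "x \<in> ?A" "card (?O g x) \<in> T" by (auto simp: cycles_in_def)
      define p where "p = card (?O g x)"
      have p: "prime p" "a < p" "p \<le> b" using x(2) by (auto simp: T_def p_def)
      have "\<nexists>m. is_cycle_perm p (g ^^ m)"
        using 3(1) p a b(1) unfolding prime_cycle_power_def
        by (metis le_less_trans less_le_trans of_nat_le_iff of_nat_less_iff)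
      then obtain y where y: "y \<in> ?A" "?O g y \<noteq> ?O g x" "p dvd card (?O g y)"
        using power_is_prime_cycle[OF g _ x(1) p(1)] by (auto simp: p_def)
      obtain k where k: "card (?O g y) = p * k" using y(3) by (auto elim: dvdE)
      have sub: "?O g y \<subseteq> ?A" by (rule permutes_orbit_subset[OF g y(1)])
      have "card (?O g y) \<noteq> 0"
        using finite_subset[OF sub] orbit_nonempty[of g y] by simp
      moreover have "card (?O g y) \<le> n" using card_mono[OF _ sub] by simp
      moreover have "k \<le> p * k" using p(1) prime_gt_0_nat[of p] by simp
      \<comment> \<open>\<open>k > 0\<close> since orbits are nonempty, and \<open>k \<le> n\<close> since the orbit has at most \<open>n\<close> points\<close>
      ultimately have k_in: "k \<in> {1..n}" using k by (cases k) auto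
      have "\<exists>x\<in>?A. \<exists>y\<in>?A. card (?O g x) = p \<and> card (?O g y) = p * k \<and> ?O g x \<noteq> ?O g y"
        by (intro bexI[of _ x] bexI[of _ y]) (use x(1) y k in \<open>auto simp only: p_def\<close>)
      then have "1 = E p (p * k) g"
        unfolding E_def by (simp only: if_True)
      also have "\<dots> \<le> (\<Sum>k\<in>{1..n}. E p (p * k) g)"
        by (rule member_le_sum) (use k_in E0 in auto)
      also have "\<dots> \<le> (\<Sum>p\<in>T. \<Sum>k\<in>{1..n}. E p (p * k) g)"
        by (rule member_le_sum) (use x(2) T E0 in \<open>auto simp: p_def intro: sum_nonneg\<close>)
      finally have "1 \<le> (\<Sum>p\<in>T. \<Sum>k\<in>{1..n}. E p (p * k) g)" .
      moreover have "0 \<le> Z g" by (simp add: Z_def)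
      ultimately show ?thesis by simp
    qed (use sum0 in \<open>auto simp: Z_def\<close>)
  qed
  also have "\<dots> = perm_mean ?A Z + (\<Sum>p\<in>T. \<Sum>k\<in>{1..n}. perm_mean ?A (E p (p * k)))"
    unfolding perm_mean_sum[symmetric] perm_mean_add ..
  also have "perm_mean ?A Z \<le> exp (-H) + exp (3 * H - real (Suc (2*m)))"
    unfolding Z_def H_def T_def[symmetric]
    by (rule perm_mean_no_cycle_in[where y = b]) (use T b(2) in \<open>auto simp: T_def\<close>)
  also have "(\<Sum>p\<in>T. \<Sum>k\<in>{1..n}. perm_mean ?A (E p (p * k)))
      \<le> (\<Sum>p\<in>T. \<Sum>k\<in>{1..n}. 1 / (real p * (real p - 1)) * (1 / real k))"
  proof (intro sum_mono)
    fix p k assume p: "p \<in> T" and k: "k \<in> {1..n}"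
    have p1: "real p > 1" using p by (auto simp: T_def dest: prime_gt_1_nat)
    have "perm_mean ?A (E p (p * k)) \<le> 1 / (real p * real (p * k))"
      unfolding E_def by (rule perm_mean_two_cycles_le) (use p1 k in auto)
    also have "\<dots> = 1 / (real p * real p) * (1 / real k)" by simp
    also have "\<dots> \<le> 1 / (real p * (real p - 1)) * (1 / real k)"
      using p1 by (intro mult_right_mono divide_left_mono mult_left_mono mult_pos_pos) auto
    finally show "perm_mean ?A (E p (p * k)) \<le> 1 / (real p * (real p - 1)) * (1 / real k)" .
  qed
  also have "\<dots> = (\<Sum>p\<in>T. 1 / (real p * (real p - 1))) * (\<Sum>k\<in>{1..n}. 1 / real k)"
    by (rule sum_product[symmetric])
  also have "\<dots> \<le> 1 / real a * (1 + ln (real n))"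
    by (intro mult_mono sum_reciprocal_consecutive_le[where b = b] sum_reciprocals_le sum_nonneg)
      (use a n in \<open>auto simp: T_def\<close>)
  finally show ?thesis by simp
qed

lemma proportion_sym_group_eq:
  "proportion (sym_group n) P = 1 - perm_mean {1..n} (\<lambda>g. if P g then 0 else 1)"
proof -
  let ?S = "{g. g permutes {1..n}}"
  have fin: "finite ?S" by (simp add: finite_permutations)
  have "real (card {g \<in> ?S. P g}) + (\<Sum>g\<in>?S. if P g then 0 else 1) = (\<Sum>g\<in>?S. 1 :: real)"
    unfolding card_eq_sum of_nat_sum of_nat_1 sum.inter_filter[OF fin] sum.distrib[symmetric]
    by (intro sum.cong) auto
  also have "\<dots> = fact n" using card_permutations[of "{1..n}" n] by simp
  finally show ?thesis
    using sym_group_card_carrier[of n]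
    by (simp add: proportion_def order_def perm_mean_def sym_group_def field_simps)
qed

lemma proportion_alt_group_ge:
  assumes "2 \<le> n"
  shows "proportion (alt_group n) P \<ge> 1 - 2 * perm_mean {1..n} (\<lambda>g. if P g then 0 else 1)"
proof -
  let ?S = "{g. g permutes {1..n}}" and ?A = "carrier (alt_group n)"
  have fin: "finite ?S" by (simp add: finite_permutations)
  have sub: "?A \<subseteq> ?S" by (auto simp: alt_group_carrier)
  have finA: "finite ?A" by (rule finite_subset[OF sub fin])
  have order: "real (card ?A) = fact n / 2"
  proof -
    have "real (2 * card ?A) = real (fact n)" by (simp only: alt_group_card_carrier[OF assms])
    then show ?thesis by simp
  qed
  have "real (card ?A) - real (card {g \<in> ?A. P g}) = (\<Sum>g\<in>?A. if P g then 0 else 1)"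
  proof -
    have "real (card {g \<in> ?A. P g}) + (\<Sum>g\<in>?A. if P g then 0 else 1) = (\<Sum>g\<in>?A. 1 :: real)"
      unfolding card_eq_sum of_nat_sum of_nat_1 sum.inter_filter[OF finA] sum.distrib[symmetric]
      by (intro sum.cong) auto
    then show ?thesis by simp
  qed
  also have "\<dots> \<le> (\<Sum>g\<in>?S. if P g then 0 else 1)"
    by (rule sum_mono2) (use fin sub in auto)
  also have "\<dots> = fact n * perm_mean {1..n} (\<lambda>g. if P g then 0 else 1)"
    by (simp add: perm_mean_def)
  finally have "real (card ?A) - real (card {g \<in> ?A. P g})
      \<le> fact n * perm_mean {1..n} (\<lambda>g. if P g then 0 else 1)" .
  then show ?thesis
    unfolding proportion_def order_def order by (simp add: field_simps)
qed

text \<open>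
  Here and in the next two lemmas \<open>exp L\<close> stands for \<open>ln n\<close> and \<open>exp (exp L)\<close> for \<open>n\<close>. The first term
  bounds \<open>exp (-H)\<close> for \<open>a\<close> about \<open>exp L * L^2\<close> and \<open>b\<close> about \<open>exp (L^2)\<close>; it is asymptotic to
  \<open>3 / L\<close>, the 3 being \<open>exp 1\<close> rounded up.
\<close>

lemma eventually_error_le:
  "\<forall>\<^sub>F L :: real in at_top. 3 * exp (2 / ln (exp L * L^2) + 3 / (exp L * L^2 - 1))
      * (ln (exp L * L^2 + 1) / ln (exp (L^2) - 1))
    + exp (-L) + (1 + exp L) / (exp L * L^2) \<le> 7 / 2 / L"
  by real_asymp

text \<open>
  Up to \<open>2 * m\<close> cycles of length at most \<open>exp (L^2)\<close> fit into \<open>n\<close> points, for \<open>m\<close> of order \<open>L^2\<close>.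
\<close>

lemma eventually_cycles_fit:
  "\<forall>\<^sub>F L :: real in at_top. 2 * (3 + 2 * L^2 + L) * exp (L^2) \<le> exp (exp L)"
  by real_asymp

lemma eventually_range_nonempty:
  "\<forall>\<^sub>F L :: real in at_top. 1 < L \<and> exp L * L^2 + 2 \<le> exp (L^2) - 1"
  by (intro eventually_conj) real_asymp+

theorem eventually_perm_mean_not_prime_cycle_power_le:
  "\<forall>\<^sub>F n in sequentially.
    perm_mean {1..n} (\<lambda>g. if prime_cycle_power n g then 0 else 1) \<le> 7 / 2 / ln (ln (real n))"
proof -
  have lim: "filterlim (\<lambda>n. ln (ln (real n))) at_top sequentially" by real_asymp
  have "\<forall>\<^sub>F n in sequentially. 2 < n" by (rule eventually_gt_at_top)
  with eventually_compose_filterlim[OF eventually_error_le lim]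
    eventually_compose_filterlim[OF eventually_cycles_fit lim]
    eventually_compose_filterlim[OF eventually_range_nonempty lim]
  show ?thesis
  proof eventually_elim
    case (elim n)
    define L where "L = ln (ln (real n))"
    note err = elim(1)[folded L_def] and fit = elim(2)[folded L_def]
    have L: "1 < L" and range: "exp L * L^2 + 2 \<le> exp (L^2) - 1" using elim(3) by (auto simp: L_def)
    have "ln (real n) > 0" using elim(4) by simp
    then have lnn: "ln (real n) = exp L" by (simp add: L_def)
    have nn: "real n = exp (exp L)" using elim(4) by (simp add: lnn[symmetric])
    define a where "a = nat \<lceil>exp L * L^2\<rceil>"
    \<comment> \<open>the largest integer strictly below \<open>exp (L^2) = ln n powr L\<close>\<close>
    define b where "b = nat \<lceil>exp (L^2)\<rceil> - 1"
    \<comment> \<open>large enough for \<open>2 * m + 1 \<ge> 3 * H + L\<close>, given \<open>H \<le> 1 + L^2\<close>\<close>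
    define m where "m = nat \<lceil>2 + 2 * L^2 + L\<rceil>"
    have "exp L * L^2 > 2"
    proof -
      have "2 < exp L" using L exp_ge_add_one_self[of L] by linarith
      then have "2 * 1 < exp L * L^2"
        using L by (intro mult_strict_mono) (auto simp: one_less_power)
      then show ?thesis by simp
    qed
    then have a: "exp L * L^2 \<le> real a" "real a < exp L * L^2 + 1" "2 < real a"
      unfolding a_def by linarith+
    have b: "real b < exp (L^2)" "exp (L^2) - 1 \<le> real b"
    proof -
      have "0 < \<lceil>exp (L^2)\<rceil>" by simp
      then have "real b = of_int \<lceil>exp (L^2)\<rceil> - 1" unfolding b_def by linarith
      then show "real b < exp (L^2)" "exp (L^2) - 1 \<le> real b" by linarith+
    qed
    have m: "2 + 2 * L^2 + L \<le> real m" "real m \<le> 3 + 2 * L^2 + L"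
      using L unfolding m_def by (simp_all add: of_nat_nat) linarith+
    have ab: "a \<le> b" using a(2) b(2) range by linarith
    let ?H = "\<Sum>p | prime p \<and> a < p \<and> p \<le> b. 1 / real p"
    have mean: "perm_mean {1..n} (\<lambda>g. if prime_cycle_power n g then 0 else 1)
        \<le> exp (- ?H) + exp (3 * ?H - real (Suc (2*m))) + (1 + ln (real n)) / real a"
    proof (rule perm_mean_not_prime_cycle_power_le)
      have "exp L \<le> exp L * L^2" using L by (simp add: one_le_power)
      then show "ln (real n) \<le> real a" using a(1) lnn by linarith
      show "real b < ln (real n) powr ln (ln (real n))"
        using b(1) by (simp add: lnn powr_def power2_eq_square)
      have "real (2 * m * b) \<le> 2 * (3 + 2 * L^2 + L) * exp (L^2)"
        using m b(1) L by (auto intro!: mult_mono)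
      then have "real (2 * m * b) \<le> real n" using fit nn by linarith
      then show "2 * m * b \<le> n" by (simp only: of_nat_le_iff)
    qed (use elim(4) a(3) in auto)
    have lna: "ln (exp L * L^2) \<le> ln (real a)" "0 < ln (exp L * L^2)" "ln (real a) \<le> ln (exp L * L^2 + 1)"
      using a \<open>exp L * L^2 > 2\<close> by auto
    have lnb: "ln (exp (L^2) - 1) \<le> ln (real b)" "0 < ln (exp (L^2) - 1)" "ln (real b) \<le> L^2"
    proof -
      have pos: "exp (L^2) - 1 > 1" using range \<open>exp L * L^2 > 2\<close> by linarith
      then show "0 < ln (exp (L^2) - 1)" by (rule ln_gt_zero)
      show "ln (exp (L^2) - 1) \<le> ln (real b)" using b(2) pos by (intro ln_mono) linarith+
      have "ln (real b) \<le> ln (exp (L^2))" using b pos by (subst ln_le_cancel_iff) auto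
      then show "ln (real b) \<le> L^2" by simp
    qed
    have "exp (- ?H) \<le> exp (1 + (2 / ln (real a) + 3 / (real a - 1)) + (ln (ln (real a)) - ln (ln (real b))))"
      using sum_prime_reciprocals_ge[of a b] a(3) ab by simp
    also have "\<dots> = exp 1 * exp (2 / ln (real a) + 3 / (real a - 1)) * (ln (real a) / ln (real b))"
      using lna lnb by (simp add: exp_add exp_diff)
    also have "\<dots> \<le> 3 * exp (2 / ln (exp L * L^2) + 3 / (exp L * L^2 - 1))
        * (ln (exp L * L^2 + 1) / ln (exp (L^2) - 1))"
      using lna lnb a \<open>exp L * L^2 > 2\<close>
      by (intro mult_mono frac_le exp_le) (auto intro!: add_mono divide_left_mono)
    finally have none: "exp (- ?H) \<le> \<dots>" .
    have "?H \<le> (\<Sum>k\<in>{1..b}. 1 / real k)"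
      by (rule sum_mono2) (auto dest: prime_ge_1_nat)
    also have "\<dots> \<le> 1 + L^2"
      using sum_reciprocals_le[of b] lnb(3) ab a(3) by simp
    finally have "3 * ?H - real (Suc (2*m)) \<le> -L" using m L by simp
    then have tail: "exp (3 * ?H - real (Suc (2*m))) \<le> exp (-L)" by simp
    have "(1 + ln (real n)) / real a \<le> (1 + exp L) / (exp L * L^2)"
      unfolding lnn using a \<open>exp L * L^2 > 2\<close> by (intro divide_left_mono) auto
    with mean none tail err show ?case by (simp only: L_def[symmetric])
  qed
qed

theorem theorem1:
  shows "\<forall>\<^sub>F n :: nat in sequentially.
      proportion (sym_group n) (prime_cycle_power n) \<ge> 1 - 5 / ln (ln (real n))
    \<and> proportion (alt_group n) (prime_cycle_power n) \<ge> 1 - 7 / ln (ln (real n))"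
proof -
  have "\<forall>\<^sub>F n :: nat in sequentially. 0 < ln (ln (real n))" by real_asymp
  with eventually_perm_mean_not_prime_cycle_power_le eventually_ge_at_top[of 2] show ?thesis
  proof eventually_elim
    case (elim n)
    let ?\<mu> = "perm_mean {1..n} (\<lambda>g. if prime_cycle_power n g then 0 else 1)"
    have "7 / 2 / ln (ln (real n)) \<le> 5 / ln (ln (real n))"
      using elim(3) by (intro divide_right_mono) auto
    then have "?\<mu> \<le> 5 / ln (ln (real n))" using elim(1) by linarith
    moreover have "2 * ?\<mu> \<le> 7 / ln (ln (real n))" using elim(1) by simp
    ultimately show ?case
      using proportion_alt_group_ge[OF elim(2), of "prime_cycle_power n"]
      by (simp add: proportion_sym_group_eq)
  qed
qed

end
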